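(* Let $N=2$, $K=2$, let $\alpha,p_1,p_2,\beta\in(0,1)$, $\beta_1=\beta_2=\beta$, and let $a_1,a_2\ge 0$ with $a_1+a_2=1$. Let $P(x_1,x_2)$, $x_1,x_2\in\{0,1,2\}$, be the stationary probabilities of the states of the system $S$ with these parameters, and let $P^*(x_1^*,x_2^* )$, $x_1^*,x_2^*\in\{0,1\}$, be the stationary probabilities of the states of the associated one-type system $S^*$. Let $p^*=\left(\frac{a_1}{p_1}+\frac{a_2}{p_2}\right)^{-1}$. Then $$P(0,0)=P^*(0,0),\quad P(0,1)=a_1P^*(0,1),\quad P(0,2)=a_2P^*(0,1),$$ $$P(1,0)=\frac{a_1p^*}{p_1}P^*(1,0),\quad P(1,1)=a_1^2P^*(1,1),\quad P(1,2)=a_1a_2P^*(1,1),$$ $$P(2,0)=\frac{a_2p^*}{p_2}P^*(1,0),\quad P(2,1)=a_1a_2P^*(1,1),\quad P(2,2)=a_2^2P^*(1,1).$$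
   Context: System $S$ (synchronous exclusion process with two particle types on an open lattice of two cells). The cells are $1$ and $2$, each containing at most one particle, and each particle is of type $1$ or $2$. A state is $(x_1,x_2)\in\{0,1,2\}^2$, where $x_i=0$ means cell $i$ is vacant and $x_i=k>0$ means cell $i$ contains a particle of type $k$. Time is discrete. Given the state at time $t$, all of the following random events are mutually independent, occur simultaneously, depend only on the configuration at time $t$, and determine the state at time $t+1$ (a finite Markov chain): (i) if cell $1$ is vacant at time $t$, then with probability $\alpha$ a particle arrives from outside and is in cell $1$ at time $t+1$; it is of type $k$ with probability $a_k$; (ii) if at time $t$ cell $1$ contains a particle of type $k$ and cell $2$ is vacant, then with probability $p_k$ this particle is in cell $2$ at time $t+1$ (and cell $1$ is then vacant), otherwise it stays; (iii) if at time $t$ cell $2$ contains a particle of type $k$, then with probability $\beta_k$ it leaves the system and cell $2$ is vacant at time $t+1$, otherwise it stays. A particle in cell $1$ stays there if cell $2$ is occupied at time $t$. System $S^*$: the same process with the same $N=2$ and $\alpha$, but with a single type of particles, whose movement probability (from cell $1$ to a vacant cell $2$) is $p^*=\left(\frac{a_1}{p_1}+\frac{a_2}{p_2}\right)^{-1}$ and whose exit probability from cell $2$ is $\beta^*=\left(\frac{a_1}{\beta_1}+\frac{a_2}{\beta_2}\right)^{-1}$ (which equals $\beta$ when $\beta_1=\beta_2=\beta$). Its states are $(x_1^*,x_2^* )\in\{0,1\}^2$ with $x_i^*=0$ if cell $i$ is vacant and $x_i^*=1$ if it is occupied. The stationary probability of a state is the limit of the probability that the system is in this state as $t\to\infty$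 (it exists and is independent of the initial state; equivalently, it is given by the unique stationary distribution of the Markov chain). *)

theory Defs
  imports "HOL-Probability.Probability"
begin

text \<open>
  Synchronous exclusion process with \<open>K\<close> particle types on an open lattice of two cells. In a state
  \<open>(x1, x2)\<close> the entry \<open>0\<close> stands for a vacant cell and \<open>k \<in> {1..K}\<close> for a particle of type \<open>k\<close>.
\<close>

definition states :: "nat \<Rightarrow> (nat \<times> nat) set" where
  "states K = {0..K} \<times> {0..K}"

text \<open>A probability distribution on \<open>{1..K}\<close> provided that the \<open>a k\<close> are nonnegative with sum \<open>1\<close>.\<close>

definition type_pmf :: "nat \<Rightarrow> (nat \<Rightarrow> real) \<Rightarrow> nat pmf" where
  "type_pmf K a = embed_pmf (\<lambda>k. if k \<in> {1..K} then a k else 0)"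

text \<open>
  All random choices are drawn independently and all updates read the state at the old time. A draw
  whose event is impossible in the current state is ignored; in particular the values \<open>p 0\<close> and
  \<open>\<beta> 0\<close> have no influence.
\<close>

definition step ::
  "nat \<Rightarrow> real \<Rightarrow> (nat \<Rightarrow> real) \<Rightarrow> (nat \<Rightarrow> real) \<Rightarrow> (nat \<Rightarrow> real) \<Rightarrow> nat \<times> nat \<Rightarrow> (nat \<times> nat) pmf" where
  "step K \<alpha> a p \<beta> = (\<lambda>(x1, x2).
     bind_pmf (bernoulli_pmf \<alpha>) (\<lambda>arrives.
     bind_pmf (type_pmf K a) (\<lambda>k.
     bind_pmf (bernoulli_pmf (p x1)) (\<lambda>moves.
     bind_pmf (bernoulli_pmf (\<beta> x2)) (\<lambda>leaves.
     return_pmf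
       (if x1 = 0 then (if arrives then k else 0)
        else if x2 = 0 \<and> moves then 0 else x1,
        if x2 = 0 then (if x1 \<noteq> 0 \<and> moves then x1 else 0)
        else if leaves then 0 else x2))))))"

definition state_dist :: "('s \<Rightarrow> 's pmf) \<Rightarrow> 's \<Rightarrow> nat \<Rightarrow> 's pmf" where
  "state_dist \<kappa> s t = ((\<lambda>D. bind_pmf D \<kappa>) ^^ t) (return_pmf s)"

definition limit_prob :: "'s set \<Rightarrow> ('s \<Rightarrow> 's pmf) \<Rightarrow> 's \<Rightarrow> real" where
  "limit_prob S \<kappa> x =
     (THE l. \<forall>s\<in>S. (\<lambda>t. pmf (state_dist \<kappa> s t) x) \<longlonglongrightarrow> l)"

definition stationary_prob ::
  "nat \<Rightarrow> real \<Rightarrow> (nat \<Rightarrow> real) \<Rightarrow> (nat \<Rightarrow> real) \<Rightarrow> (nat \<Rightarrow> real) \<Rightarrow> nat \<times> nat \<Rightarrow> real" where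
  "stationary_prob K \<alpha> a p \<beta> = limit_prob (states K) (step K \<alpha> a p \<beta>)"

text \<open>The same process with a single type of particles; state entries are \<open>0\<close> and \<open>1\<close>.\<close>

definition one_type_stationary_prob :: "real \<Rightarrow> real \<Rightarrow> real \<Rightarrow> nat \<times> nat \<Rightarrow> real" where
  "one_type_stationary_prob \<alpha> p \<beta> = stationary_prob 1 \<alpha> (\<lambda>_. 1) (\<lambda>_. p) (\<lambda>_. \<beta>)"

end

theory Submission
  imports Defs
begin

text \<open>
  For a common exit probability the stationary distribution is explicit for any number of types: up
  to normalisation it is \<open>(1 - \<alpha>) \<beta> / \<alpha>\<close> at \<open>(0, 0)\<close>, \<open>a j\<close> at \<open>(0, j)\<close>,
  \<open>a k (\<alpha> + \<beta> - \<alpha> \<beta>) / p k\<close> at \<open>(k, 0)\<close> and \<open>a k a j \<alpha> (1 - \<beta>) / \<beta>\<close> at \<open>(k, j)\<close>. The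
  normalising constant depends on the \<open>p k\<close> only through \<open>\<Sum>k. a k / p k\<close>, which is the same for the
  one-type system. The chain converges since \<open>(0, 0)\<close> is reachable from every state in exactly three
  steps, so that the three-step kernel is a strict \<open>\<ell>\<^sup>1\<close>-contraction on signed measures of mass zero.
\<close>

section \<open>Convergence of finite Markov chains\<close>

lemma pmf_bind_finite:
  assumes "finite S" "set_pmf D \<subseteq> S"
  shows "pmf (bind_pmf D \<kappa>) x = (\<Sum>y\<in>S. pmf D y * pmf (\<kappa> y) x)"
  unfolding pmf_bind using assms
  by (subst integral_measure_pmf[where A = S]) auto

text \<open>Doeblin's argument: taking \<epsilon> off column \<open>z\<close> leaves a nonnegative
  kernel \<open>R\<close> with row sums \<open>1 - \<epsilon>\<close>, and the removed part
  contributes \<open>\<epsilon> * sum v S = 0\<close>. The case \<open>\<epsilon> = 0\<close> is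
  included and says that the kernel is nonexpansive.\<close>

lemma kernel_contraction:
  fixes v :: "'s \<Rightarrow> real"
  assumes "finite S" "z \<in> S"
    and supp: "\<And>x. x \<in> S \<Longrightarrow> set_pmf (Q x) \<subseteq> S"
    and minor: "\<And>x. x \<in> S \<Longrightarrow> \<epsilon> \<le> pmf (Q x) z"
    and zero: "sum v S = 0"
  shows "(\<Sum>y\<in>S. \<bar>\<Sum>x\<in>S. v x * pmf (Q x) y\<bar>) \<le> (1 - \<epsilon>) * (\<Sum>x\<in>S. \<bar>v x\<bar>)"
proof -
  define R where "R x y = pmf (Q x) y - (if y = z then \<epsilon> else 0)" for x y
  have R_nonneg: "0 \<le> R x y" if "x \<in> S" for x y
    using minor[OF that] by (simp add: R_def)
  have R_sum: "(\<Sum>y\<in>S. R x y) = 1 - \<epsilon>" if "x \<in> S" for x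
    using assms(1,2) sum_pmf_eq_1[OF assms(1) supp[OF that]]
    by (simp add: R_def sum_subtractf)
  have "(\<Sum>x\<in>S. v x * pmf (Q x) y) = (\<Sum>x\<in>S. v x * R x y)" for y
    using zero by (simp add: R_def right_diff_distrib sum_subtractf flip: sum_distrib_right)
  hence "(\<Sum>y\<in>S. \<bar>\<Sum>x\<in>S. v x * pmf (Q x) y\<bar>) = (\<Sum>y\<in>S. \<bar>\<Sum>x\<in>S. v x * R x y\<bar>)"
    by simp
  also have "\<dots> \<le> (\<Sum>y\<in>S. \<Sum>x\<in>S. \<bar>v x\<bar> * R x y)"
    using R_nonneg by (intro sum_mono order.trans[OF sum_abs]) (simp add: abs_mult)
  also have "\<dots> = (\<Sum>x\<in>S. \<bar>v x\<bar> * (\<Sum>y\<in>S. R x y))"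
    by (subst sum.swap) (simp add: sum_distrib_left)
  also have "\<dots> = (1 - \<epsilon>) * (\<Sum>x\<in>S. \<bar>v x\<bar>)"
    by (simp add: R_sum sum_distrib_left mult.commute)
  finally show ?thesis .
qed

section \<open>Iterated distributions and their limit\<close>

lemma state_dist_0 [simp]: "state_dist \<kappa> s 0 = return_pmf s"
  by (simp add: state_dist_def)

lemma state_dist_Suc [simp]: "state_dist \<kappa> s (Suc t) = bind_pmf (state_dist \<kappa> s t) \<kappa>"
  by (simp add: state_dist_def)

lemma state_dist_add:
  "state_dist \<kappa> s (t + n) = bind_pmf (state_dist \<kappa> s t) (\<lambda>y. state_dist \<kappa> y n)"
  by (induction n) (simp_all add: bind_return_pmf' bind_assoc_pmf)

lemma set_state_dist_subset:
  assumes "\<And>x. x \<in> S \<Longrightarrow> set_pmf (\<kappa> x) \<subseteq> S" "s \<in> S"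
  shows "set_pmf (state_dist \<kappa> s t) \<subseteq> S"
proof (induction t)
  case 0
  show ?case using \<open>s \<in> S\<close> by simp
next
  case (Suc t)
  show ?case
    unfolding state_dist_Suc set_bind_pmf
    by (intro UN_least assms(1) subsetD[OF Suc])
qed

lemma invariant_state_dist:
  assumes "finite S"
    and supp: "\<And>x. x \<in> S \<Longrightarrow> set_pmf (\<kappa> x) \<subseteq> S"
    and inv: "\<And>y. y \<in> S \<Longrightarrow> (\<Sum>x\<in>S. \<pi> x * pmf (\<kappa> x) y) = \<pi> y"
    and "y \<in> S"
  shows "(\<Sum>x\<in>S. \<pi> x * pmf (state_dist \<kappa> x n) y) = \<pi> y"
  using \<open>y \<in> S\<close>
proof (induction n arbitrary: y)
  case 0
  thus ?case using \<open>finite S\<close> by (simp add: indicator_def if_distrib[of "\<lambda>c. _ * c"] eq_commute cong: if_cong)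
next
  case (Suc n)
  have "(\<Sum>x\<in>S. \<pi> x * pmf (state_dist \<kappa> x (Suc n)) y)
      = (\<Sum>x\<in>S. \<Sum>w\<in>S. \<pi> x * pmf (state_dist \<kappa> x n) w * pmf (\<kappa> w) y)"
    by (intro sum.cong refl)
       (simp add: pmf_bind_finite[OF \<open>finite S\<close> set_state_dist_subset[OF supp]] sum_distrib_left mult.assoc)
  also have "\<dots> = (\<Sum>w\<in>S. \<pi> w * pmf (\<kappa> w) y)"
    by (subst sum.swap) (simp add: Suc.IH flip: sum_distrib_right)
  finally show ?case using inv Suc.prems by simp
qed

theorem state_dist_tendsto_invariant:
  fixes \<pi> :: "'s \<Rightarrow> real"
  assumes "finite S"
    and supp: "\<And>x. x \<in> S \<Longrightarrow> set_pmf (\<kappa> x) \<subseteq> S"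
    and reach: "\<And>x. x \<in> S \<Longrightarrow> z \<in> set_pmf (state_dist \<kappa> x n)"
    and inv: "\<And>y. y \<in> S \<Longrightarrow> (\<Sum>x\<in>S. \<pi> x * pmf (\<kappa> x) y) = \<pi> y"
    and total: "sum \<pi> S = 1"
    and "s \<in> S" "x \<in> S"
  shows "(\<lambda>t. pmf (state_dist \<kappa> s t) x) \<longlonglongrightarrow> \<pi> x"
proof -
  have supp': "set_pmf (state_dist \<kappa> x t) \<subseteq> S" if "x \<in> S" for x t
    using supp that by (rule set_state_dist_subset)
  have "z \<in> S" using subsetD[OF supp' reach] \<open>s \<in> S\<close> by blast
  \<comment> \<open>Reachability of \<open>z\<close> holds with the same \<open>n\<close> for all
    states, so on the finite set \<open>S\<close> the n-step probability of hitting \<open>z\<close>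
    has a positive lower bound.\<close>
  define \<epsilon> where "\<epsilon> = Min ((\<lambda>x. pmf (state_dist \<kappa> x n) z) ` S)"
  have "\<epsilon> > 0"
    unfolding \<epsilon>_def using \<open>finite S\<close> \<open>s \<in> S\<close> reach
    by (subst Min_gr_iff) (auto simp: pmf_positive)
  have minor: "\<epsilon> \<le> pmf (state_dist \<kappa> x n) z" if "x \<in> S" for x
    unfolding \<epsilon>_def using \<open>finite S\<close> that by simp
  define d where "d t = (\<Sum>y\<in>S. \<bar>pmf (state_dist \<kappa> s t) y - \<pi> y\<bar>)" for t
  have contract: "d (t + m) \<le> (1 - c) * d t"
    if "\<And>x. x \<in> S \<Longrightarrow> c \<le> pmf (state_dist \<kappa> x m) z" for t m c
  proof -
    \<comment> \<open>Invariance of \<pi> under the m-step kernel turns the error at time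
      \<open>t + m\<close> into the image of the error at time \<open>t\<close>, a signed measure of
      mass zero.\<close>
    have "pmf (state_dist \<kappa> s (t + m)) y - \<pi> y
        = (\<Sum>x\<in>S. (pmf (state_dist \<kappa> s t) x - \<pi> x) * pmf (state_dist \<kappa> x m) y)" if "y \<in> S" for y
      unfolding state_dist_add pmf_bind_finite[OF \<open>finite S\<close> supp'[OF \<open>s \<in> S\<close>]]
      using invariant_state_dist[OF \<open>finite S\<close> supp inv that]
      by (simp add: left_diff_distrib sum_subtractf)
    hence "d (t + m)
        = (\<Sum>y\<in>S. \<bar>\<Sum>x\<in>S. (pmf (state_dist \<kappa> s t) x - \<pi> x) * pmf (state_dist \<kappa> x m) y\<bar>)"
      unfolding d_def by simp
    also have "\<dots> \<le> (1 - c) * d t"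
      unfolding d_def
    proof (rule kernel_contraction[OF \<open>finite S\<close> \<open>z \<in> S\<close>])
      show "(\<Sum>x\<in>S. pmf (state_dist \<kappa> s t) x - \<pi> x) = 0"
        using sum_pmf_eq_1[OF \<open>finite S\<close> supp'[OF \<open>s \<in> S\<close>]] total by (simp add: sum_subtractf)
    qed (fact supp' that)+
    finally show ?thesis .
  qed
  have d_nonneg: "0 \<le> d t" for t by (simp add: d_def sum_nonneg)
  \<comment> \<open>One step with \<open>c = 0\<close> only gives monotonicity, but this makes the
    whole sequence converge; the strict n-step contraction, passed to the limit, then forces
    \<open>L = 0\<close>.\<close>
  have "decseq d" using contract[of 0 1, OF pmf_nonneg] by (intro decseq_SucI) simp
  then obtain L where L: "d \<longlonglongrightarrow> L"
    using decseq_convergent d_nonneg by metis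
  have "L \<ge> 0" using LIMSEQ_le_const[OF L] d_nonneg by blast
  have "L \<le> (1 - \<epsilon>) * L"
    by (rule LIMSEQ_le[OF LIMSEQ_ignore_initial_segment[OF L, of n] tendsto_mult_left[OF L]])
       (use contract[OF minor] in auto)
  hence "\<epsilon> * L \<le> 0" by (simp add: algebra_simps)
  hence "L = 0" using \<open>\<epsilon> > 0\<close> \<open>L \<ge> 0\<close> by (simp add: mult_le_0_iff)
  have "\<bar>pmf (state_dist \<kappa> s t) x - \<pi> x\<bar> \<le> d t" for t
    unfolding d_def using \<open>finite S\<close> \<open>x \<in> S\<close> by (intro member_le_sum) auto
  hence "\<forall>\<^sub>F t in sequentially. norm (pmf (state_dist \<kappa> s t) x - \<pi> x) \<le> d t"
    by simp
  hence "(\<lambda>t. pmf (state_dist \<kappa> s t) x - \<pi> x) \<longlonglongrightarrow> 0"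
    by (rule Lim_null_comparison) (use L \<open>L = 0\<close> in simp)
  thus ?thesis by (simp add: LIM_zero_iff)
qed

corollary limit_prob_eq_invariant:
  fixes \<pi> :: "'s \<Rightarrow> real"
  assumes "finite S"
    and "\<And>x. x \<in> S \<Longrightarrow> set_pmf (\<kappa> x) \<subseteq> S"
    and "\<And>x. x \<in> S \<Longrightarrow> z \<in> set_pmf (state_dist \<kappa> x n)"
    and "\<And>y. y \<in> S \<Longrightarrow> (\<Sum>x\<in>S. \<pi> x * pmf (\<kappa> x) y) = \<pi> y"
    and "sum \<pi> S = 1"
    and "x \<in> S"
  shows "limit_prob S \<kappa> x = \<pi> x"
  unfolding limit_prob_def
proof (rule the_equality)
  show "\<forall>s\<in>S. (\<lambda>t. pmf (state_dist \<kappa> s t) x) \<longlonglongrightarrow> \<pi> x"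
    using state_dist_tendsto_invariant[OF assms(1-5) _ \<open>x \<in> S\<close>] by blast
  \<comment> \<open>The quantifier over initial states is not vacuous: \<open>x\<close> itself may
    serve as one, and uniqueness of limits applies.\<close>
  thus "l = \<pi> x" if "\<forall>s\<in>S. (\<lambda>t. pmf (state_dist \<kappa> s t) x) \<longlonglongrightarrow> l" for l
    using that \<open>x \<in> S\<close> LIMSEQ_unique by blast
qed

section \<open>The exclusion process with a common exit probability\<close>

text \<open>Scaled so that the states \<open>(0, j)\<close> with a particle in cell 2 have total
  weight 1. A particle of type \<open>k\<close> facing a vacant cell waits a geometric time of mean
  \<open>1 / p k\<close>, whence \<open>a k / p k\<close>; the factor
  \<open>\<alpha> + \<beta> - \<alpha> * \<beta>\<close> is the total flow entering the states
  \<open>(k, 0)\<close> from all other patterns.\<close>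

definition two_cell_weight :: "real \<Rightarrow> (nat \<Rightarrow> real) \<Rightarrow> (nat \<Rightarrow> real) \<Rightarrow> real \<Rightarrow> nat \<times> nat \<Rightarrow> real" where
  "two_cell_weight \<alpha> a p \<beta> = (\<lambda>(x1, x2).
     if x1 = 0 then (if x2 = 0 then (1 - \<alpha>) * \<beta> / \<alpha> else a x2)
     else if x2 = 0 then a x1 / p x1 * (\<alpha> + \<beta> - \<alpha> * \<beta>)
     else a x1 * a x2 * (\<alpha> * (1 - \<beta>) / \<beta>))"

lemma sum_states:
  fixes f :: "nat \<times> nat \<Rightarrow> real"
  shows "sum f (states K) = f (0, 0) + (\<Sum>j=1..K. f (0, j)) + (\<Sum>k=1..K. f (k, 0))
           + (\<Sum>k=1..K. \<Sum>j=1..K. f (k, j))"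
proof -
  have "sum f (states K) = (\<Sum>x1=0..K. \<Sum>x2=0..K. f (x1, x2))"
    by (simp add: states_def sum.cartesian_product)
  also have "\<dots> = (f (0, 0) + (\<Sum>j=1..K. f (0, j))) + (\<Sum>k=1..K. f (k, 0) + (\<Sum>j=1..K. f (k, j)))"
    by (simp add: sum.atLeast_Suc_atMost)
  finally show ?thesis by (simp add: sum.distrib)
qed

lemma pmf_type_pmf:
  assumes "\<And>k. k \<in> {1..K} \<Longrightarrow> 0 \<le> a k" "(\<Sum>k=1..K. a k) = 1"
  shows "pmf (type_pmf K a) k = (if k \<in> {1..K} then a k else 0)"
  unfolding type_pmf_def
proof (rule pmf_embed_pmf)
  have "(\<integral>\<^sup>+ k. ennreal (if k \<in> {1..K} then a k else 0) \<partial>count_space UNIV)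
      = (\<Sum>k=1..K. ennreal (a k))"
    by (subst nn_integral_count_space'[where A = "{1..K}"]) (auto simp: assms)
  also have "\<dots> = 1" using assms by (subst sum_ennreal) auto
  finally show "(\<integral>\<^sup>+ k. ennreal (if k \<in> {1..K} then a k else 0) \<partial>count_space UNIV) = 1" .
qed (use assms in auto)

text \<open>\<open>K\<close> stays general so that the two-type and the one-type system are both
  instances. The function \<open>b\<close> is fixed to \<beta> on actual types only, since the draw
  made with \<open>b 0\<close> is ignored.\<close>

locale two_cell_process =
  fixes K :: nat and \<alpha> \<beta> :: real and a p b :: "nat \<Rightarrow> real"
  assumes \<alpha>: "0 < \<alpha>" "\<alpha> < 1"
    and \<beta>: "0 < \<beta>" "\<beta> < 1"
    and b: "\<And>k. k \<in> {1..K} \<Longrightarrow> b k = \<beta>"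
    and p: "\<And>k. k \<in> {1..K} \<Longrightarrow> 0 < p k" "\<And>k. k \<in> {1..K} \<Longrightarrow> p k \<le> 1"
    and a_nonneg: "\<And>k. k \<in> {1..K} \<Longrightarrow> 0 \<le> a k"
    and a_sum: "(\<Sum>k=1..K. a k) = 1"
begin

section \<open>One-step transition probabilities\<close>

abbreviation (input) "\<kappa> \<equiv> step K \<alpha> a p b"

lemma type_expectation:
  "measure_pmf.expectation (type_pmf K a) f = (\<Sum>k=1..K. a k * f k :: real)"
proof -
  have type: "pmf (type_pmf K a) k = (if k \<in> {1..K} then a k else 0)" for k
    using a_nonneg a_sum by (rule pmf_type_pmf)
  show ?thesis
    by (subst integral_measure_pmf[where A = "{1..K}"])
       (auto simp: type set_pmf_iff split: if_splits)
qed

text \<open>Law of the content of cell 1 one step after it was vacant. It is meaningful only up to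
  \<open>K\<close>, beyond which \<open>a\<close> is unconstrained; hence the range conditions on
  \<open>y1\<close> below.\<close>

definition arrival :: "nat \<Rightarrow> real" where
  "arrival y = (if y = 0 then 1 - \<alpha> else \<alpha> * a y)"

lemma pmf_step_empty:
  assumes "y1 \<in> {0..K}"
  shows "pmf (\<kappa> (0, 0)) (y1, y2) = of_bool (y2 = 0) * arrival y1"
  using \<alpha> assms a_sum
  by (auto simp: step_def pmf_bind type_expectation arrival_def indicator_def
      if_distrib[of "\<lambda>c. _ * c"] cong: if_cong)

text \<open>With cell 1 vacant nothing can move between the cells, so arrival and exit are
  independent and the probability is a product.\<close>

lemma pmf_step_right:
  assumes "y1 \<in> {0..K}" "j \<in> {1..K}"
  shows "pmf (\<kappa> (0, j)) (y1, y2) = arrival y1 * (of_bool (y2 = 0) * \<beta> + of_bool (y2 = j) * (1 - \<beta>))"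
  using \<alpha> \<beta> b[of j] assms a_sum
  by (auto simp: step_def pmf_bind type_expectation arrival_def indicator_def
      of_bool_def if_distrib[of "\<lambda>c. _ * c"] if_distrib[of "\<lambda>c. c * _"]
      simp flip: sum_distrib_right cong: if_cong)

lemma pmf_step_left:
  assumes "k \<in> {1..K}"
  shows "pmf (\<kappa> (k, 0)) (y1, y2)
       = of_bool (y1 = 0 \<and> y2 = k) * p k + of_bool (y1 = k \<and> y2 = 0) * (1 - p k)"
  using p[of k] assms
  by (auto simp: step_def pmf_bind indicator_def)

text \<open>Updates read the old state: the particle in cell 1 is blocked even when the other one
  leaves in the same step.\<close>

lemma pmf_step_full:
  assumes "k \<in> {1..K}" "j \<in> {1..K}"
  shows "pmf (\<kappa> (k, j)) (y1, y2)
       = of_bool (y1 = k) * (of_bool (y2 = 0) * \<beta> + of_bool (y2 = j) * (1 - \<beta>))"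
  using \<beta> b[of j] assms
  by (auto simp: step_def pmf_bind indicator_def)

section \<open>Flow into a state from each occupancy pattern\<close>

lemma sum_right:
  assumes "y1 \<in> {0..K}" "y2 \<in> {0..K}"
  shows "(\<Sum>j=1..K. a j * pmf (\<kappa> (0, j)) (y1, y2))
       = arrival y1 * (if y2 = 0 then \<beta> else a y2 * (1 - \<beta>))"
proof -
  have "(\<Sum>j=1..K. a j * pmf (\<kappa> (0, j)) (y1, y2))
      = (\<Sum>j=1..K. arrival y1 * (of_bool (y2 = 0) * \<beta> * a j + (if j = y2 then a j * (1 - \<beta>) else 0)))"
    using assms by (intro sum.cong refl) (auto simp: pmf_step_right algebra_simps)
  \<comment> \<open>Exits of all types lead to the same vacant cell 2. As \<beta> is common to the
    types it factors out, and the \<open>a j\<close> sum to 1.\<close>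
  also have "\<dots> = arrival y1 * (of_bool (y2 = 0) * \<beta> * (\<Sum>j=1..K. a j)
                 + (\<Sum>j=1..K. if j = y2 then a j * (1 - \<beta>) else 0))"
    by (simp only: sum.distrib flip: sum_distrib_left)
  finally show ?thesis using assms(2) a_sum by auto
qed

text \<open>The movement probability \<open>p k\<close> cancels the mean waiting time
  \<open>1 / p k\<close>, so the flow into \<open>(0, k)\<close> is proportional to
  \<open>a k\<close> whatever the speed of the type.\<close>

lemma sum_left:
  assumes "y1 \<in> {0..K}" "y2 \<in> {0..K}"
  shows "(\<Sum>k=1..K. a k / p k * pmf (\<kappa> (k, 0)) (y1, y2))
       = (if y1 = 0 \<and> y2 \<noteq> 0 then a y2 else if y1 \<noteq> 0 \<and> y2 = 0 then a y1 / p y1 * (1 - p y1) else 0)"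
proof -
  have "(\<Sum>k=1..K. a k / p k * pmf (\<kappa> (k, 0)) (y1, y2))
      = (\<Sum>k=1..K. (if k = y2 then of_bool (y1 = 0) * a k else 0)
          + (if k = y1 then of_bool (y2 = 0) * (a k / p k * (1 - p k)) else 0))"
  proof (intro sum.cong refl)
    fix k assume "k \<in> {1..K}"
    thus "a k / p k * pmf (\<kappa> (k, 0)) (y1, y2)
        = (if k = y2 then of_bool (y1 = 0) * a k else 0)
          + (if k = y1 then of_bool (y2 = 0) * (a k / p k * (1 - p k)) else 0)"
      using p(1)[of k] by (auto simp: pmf_step_left)
  qed
  thus ?thesis using assms by (auto simp: sum.distrib)
qed

text \<open>Cell 1 is frozen and the two types carry product weights, so the double sum splits into
  one factor per cell.\<close>

lemma sum_full:
  assumes "y1 \<in> {0..K}" "y2 \<in> {0..K}"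
  shows "(\<Sum>k=1..K. \<Sum>j=1..K. a k * a j * pmf (\<kappa> (k, j)) (y1, y2))
       = (if y1 = 0 then 0 else a y1) * (if y2 = 0 then \<beta> else a y2 * (1 - \<beta>))"
proof -
  have "(\<Sum>k=1..K. \<Sum>j=1..K. a k * a j * pmf (\<kappa> (k, j)) (y1, y2))
      = (\<Sum>k=1..K. (if k = y1 then a k else 0)
          * (\<Sum>j=1..K. of_bool (y2 = 0) * \<beta> * a j + (if j = y2 then a j * (1 - \<beta>) else 0)))"
    unfolding sum_distrib_left
    by (intro sum.cong refl) (auto simp: pmf_step_full algebra_simps)
  also have "\<dots> = (\<Sum>k=1..K. if k = y1 then a k else 0)
          * (of_bool (y2 = 0) * \<beta> * (\<Sum>j=1..K. a j) + (\<Sum>j=1..K. if j = y2 then a j * (1 - \<beta>) else 0))"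
    by (simp only: sum_distrib_left sum_distrib_right sum.distrib)
  finally show ?thesis using assms a_sum by auto
qed

lemma two_cell_weight_invariant:
  assumes "y \<in> states K"
  shows "(\<Sum>x\<in>states K. two_cell_weight \<alpha> a p \<beta> x * pmf (\<kappa> x) y) = two_cell_weight \<alpha> a p \<beta> y"
proof -
  obtain y1 y2 where y: "y = (y1, y2)" "y1 \<in> {0..K}" "y2 \<in> {0..K}"
    using assms by (auto simp: states_def)
  let ?c = "\<alpha> + \<beta> - \<alpha> * \<beta>" and ?d = "\<alpha> * (1 - \<beta>) / \<beta>"
  have "(\<Sum>x\<in>states K. two_cell_weight \<alpha> a p \<beta> x * pmf (\<kappa> x) y)
      = (1 - \<alpha>) * \<beta> / \<alpha> * pmf (\<kappa> (0, 0)) (y1, y2)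
        + (\<Sum>j=1..K. a j * pmf (\<kappa> (0, j)) (y1, y2))
        + ?c * (\<Sum>k=1..K. a k / p k * pmf (\<kappa> (k, 0)) (y1, y2))
        + ?d * (\<Sum>k=1..K. \<Sum>j=1..K. a k * a j * pmf (\<kappa> (k, j)) (y1, y2))"
    unfolding sum_states sum_distrib_left y(1)
    by (intro arg_cong2[of _ _ _ _ "(+)"] sum.cong refl) (auto simp: two_cell_weight_def)
  also have "\<dots> = two_cell_weight \<alpha> a p \<beta> y"
    \<comment> \<open>What remains is one rational identity for each of the four occupancy patterns
      of \<open>y\<close>; positivity of \<open>p y1\<close> for an actual type \<open>y1\<close>
      allows clearing denominators.\<close>
    unfolding sum_right[OF y(2,3)] sum_left[OF y(2,3)] sum_full[OF y(2,3)] pmf_step_empty[OF y(2)] y(1)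
    using \<alpha> \<beta> p(1)[of y1] y(2)
    by (auto simp: two_cell_weight_def arrival_def divide_simps) (simp_all add: algebra_simps)
  finally show ?thesis .
qed

section \<open>Reachability and normalisation\<close>

lemma set_step_subset:
  assumes "x \<in> states K"
  shows "set_pmf (\<kappa> x) \<subseteq> states K"
proof -
  have "set_pmf (type_pmf K a) \<subseteq> {1..K}"
    using pmf_type_pmf[OF a_nonneg a_sum] by (auto simp: set_pmf_iff split: if_splits)
  thus ?thesis using assms by (auto simp: step_def states_def split: if_splits)
qed

text \<open>The longest path is \<open>(k, j)\<close>, \<open>(k, 0)\<close>, \<open>(0, k)\<close>,
  \<open>(0, 0)\<close>. Shorter ones are padded to three steps by waiting in \<open>(0, 0)\<close>,
  which has positive probability because \<open>\<alpha> < 1\<close>.\<close>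

lemma empty_state_reachable:
  assumes "x \<in> states K"
  shows "(0, 0) \<in> set_pmf (state_dist \<kappa> x 3)"
proof -
  have empty: "(0, 0) \<in> set_pmf (\<kappa> (0, 0))"
    using \<alpha> by (simp add: set_pmf_iff pmf_step_empty arrival_def)
  have right: "(0, 0) \<in> set_pmf (\<kappa> (0, j))" if "j \<in> {1..K}" for j
    using that \<alpha> \<beta> by (simp add: set_pmf_iff pmf_step_right arrival_def)
  have left: "(0, k) \<in> set_pmf (\<kappa> (k, 0))" if "k \<in> {1..K}" for k
    using that p(1)[OF that] by (simp add: set_pmf_iff pmf_step_left)
  have full: "(k, 0) \<in> set_pmf (\<kappa> (k, j))" if "k \<in> {1..K}" "j \<in> {1..K}" for k j
    using that \<beta> by (simp add: set_pmf_iff pmf_step_full)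
  obtain x1 x2 where x: "x = (x1, x2)" "x1 = 0 \<or> x1 \<in> {1..K}" "x2 = 0 \<or> x2 \<in> {1..K}"
    using assms by (force simp: states_def)
  have "\<exists>y\<in>set_pmf (\<kappa> x). \<exists>w\<in>set_pmf (\<kappa> y). (0, 0) \<in> set_pmf (\<kappa> w)"
    using x empty right left full by metis
  thus ?thesis by (simp add: numeral_3_eq_3)
qed

text \<open>The four summands are the total weights of the patterns: both cells vacant, only cell 2
  occupied, only cell 1 occupied, both occupied.\<close>

definition normaliser :: real where
  "normaliser = (1 - \<alpha>) * \<beta> / \<alpha> + 1 + (\<alpha> + \<beta> - \<alpha> * \<beta>) * (\<Sum>k=1..K. a k / p k) + \<alpha> * (1 - \<beta>) / \<beta>"

lemma sum_two_cell_weight: "sum (two_cell_weight \<alpha> a p \<beta>) (states K) = normaliser"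
proof -
  have "(\<Sum>k=1..K. \<Sum>j=1..K. a k * a j * (\<alpha> * (1 - \<beta>) / \<beta>)) = \<alpha> * (1 - \<beta>) / \<beta>"
    using a_sum by (simp only: flip: sum_distrib_left sum_distrib_right)
  moreover have "(\<Sum>k=1..K. a k / p k * (\<alpha> + \<beta> - \<alpha> * \<beta>)) = (\<alpha> + \<beta> - \<alpha> * \<beta>) * (\<Sum>k=1..K. a k / p k)"
    by (simp add: sum_distrib_left mult.commute)
  ultimately show ?thesis
    using a_sum by (simp add: sum_states two_cell_weight_def normaliser_def)
qed

lemma normaliser_pos: "normaliser > 0"
proof -
  have "(\<Sum>k=1..K. a k / p k) \<ge> 0"
    using a_nonneg p(1) by (intro sum_nonneg divide_nonneg_pos) auto
  moreover have "\<alpha> + \<beta> - \<alpha> * \<beta> > 0"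
    using \<alpha> \<beta> mult_strict_mono[of \<alpha> 1 \<beta> 1] by (smt (verit) mult_less_cancel_right1)
  moreover have "(1 - \<alpha>) * \<beta> / \<alpha> > 0" "\<alpha> * (1 - \<beta>) / \<beta> > 0"
    using \<alpha> \<beta> by simp_all
  ultimately show ?thesis
    unfolding normaliser_def by (intro add_pos_pos add_pos_nonneg mult_nonneg_nonneg) auto
qed

theorem stationary_prob_eq:
  assumes "x \<in> states K"
  shows "stationary_prob K \<alpha> a p b x = two_cell_weight \<alpha> a p \<beta> x / normaliser"
  unfolding stationary_prob_def
proof (rule limit_prob_eq_invariant[OF _ set_step_subset empty_state_reachable])
  show "finite (states K)" by (simp add: states_def)
  show "(\<Sum>x\<in>states K. two_cell_weight \<alpha> a p \<beta> x / normaliser * pmf (\<kappa> x) y)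
      = two_cell_weight \<alpha> a p \<beta> y / normaliser" if "y \<in> states K" for y
    using two_cell_weight_invariant[OF that] by (simp flip: sum_divide_distrib)
  show "(\<Sum>x\<in>states K. two_cell_weight \<alpha> a p \<beta> x / normaliser) = 1"
    using normaliser_pos sum_two_cell_weight by (simp flip: sum_divide_distrib)
qed (use assms in auto)

end

section \<open>Comparison of the two-type and the one-type system\<close>

theorem theorem2:
  fixes \<alpha> \<beta> pstar \<beta>star :: real
    and a p b :: "nat \<Rightarrow> real"
    and P Pstar :: "nat \<times> nat \<Rightarrow> real"
  assumes "0 < \<alpha>" "\<alpha> < 1"
    and "0 < p 1" "p 1 < 1" "0 < p 2" "p 2 < 1"
    and "0 < \<beta>" "\<beta> < 1" "b 1 = \<beta>" "b 2 = \<beta>"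
    and "0 \<le> a 1" "0 \<le> a 2" "a 1 + a 2 = 1"
    and "pstar = inverse (a 1 / p 1 + a 2 / p 2)"
    and "\<beta>star = inverse (a 1 / b 1 + a 2 / b 2)"
    and "P = stationary_prob 2 \<alpha> a p b"
    and "Pstar = one_type_stationary_prob \<alpha> pstar \<beta>star"
  shows "P (0, 0) = Pstar (0, 0) \<and>
         P (0, 1) = a 1 * Pstar (0, 1) \<and>
         P (0, 2) = a 2 * Pstar (0, 1) \<and>
         P (1, 0) = a 1 * pstar / p 1 * Pstar (1, 0) \<and>
         P (1, 1) = (a 1)\<^sup>2 * Pstar (1, 1) \<and>
         P (1, 2) = a 1 * a 2 * Pstar (1, 1) \<and>
         P (2, 0) = a 2 * pstar / p 2 * Pstar (1, 0) \<and>
         P (2, 1) = a 1 * a 2 * Pstar (1, 1) \<and>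
         P (2, 2) = (a 2)\<^sup>2 * Pstar (1, 1)"
proof -
  \<comment> \<open>These bounds show that \<open>pstar\<close> is at most 1, hence a genuine
    movement probability for the one-type instance.\<close>
  have "a 1 \<le> a 1 / p 1" "a 2 \<le> a 2 / p 2"
    using assms(3-6,11,12) by (simp_all add: le_divide_eq mult_left_le)
  hence "1 \<le> a 1 / p 1 + a 2 / p 2" using assms(13) by linarith
  hence pstar: "0 < pstar" "pstar \<le> 1" "1 / pstar = a 1 / p 1 + a 2 / p 2"
    using assms(14) by (auto simp: inverse_le_1_iff inverse_eq_divide)
  have \<beta>star: "\<beta>star = \<beta>"
    using assms(7,9,10,13,15) by (simp flip: add_divide_distrib)
  have sum2: "(\<Sum>k=1..2. f k) = f 1 + f 2" for f :: "nat \<Rightarrow> real"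
    by (simp add: eval_nat_numeral)
  have types: "b k = \<beta> \<and> 0 < p k \<and> p k \<le> 1 \<and> 0 \<le> a k" if "k \<in> {1..2}" for k
  proof -
    have "k = 1 \<or> k = 2" using that by auto
    thus ?thesis using assms(3-6,9-12) by (elim disjE) simp_all
  qed
  interpret S: two_cell_process 2 \<alpha> \<beta> a p b
    using assms(1,2,7,8,13) sum2[of a] types by (simp add: two_cell_process_def)
  interpret S': two_cell_process 1 \<alpha> \<beta> "\<lambda>_. 1" "\<lambda>_. pstar" "\<lambda>_. \<beta>star"
    by standard (use assms(1,2,7,8) pstar(1,2) \<beta>star in simp_all)
  \<comment> \<open>The choice of \<open>pstar\<close> enters here: the one-type sum is
    \<open>1 / pstar\<close>, which equals \<open>a 1 / p 1 + a 2 / p 2\<close>.\<close>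
  have norm: "S'.normaliser = S.normaliser"
    unfolding S'.normaliser_def S.normaliser_def sum2 using pstar(3) by simp
  have P: "P x = two_cell_weight \<alpha> a p \<beta> x / S.normaliser" if "x \<in> states 2" for x
    using S.stationary_prob_eq[OF that] assms(16) by simp
  have Pstar: "Pstar x = two_cell_weight \<alpha> (\<lambda>_. 1) (\<lambda>_. pstar) \<beta> x / S.normaliser"
    if "x \<in> states 1" for x
    using S'.stationary_prob_eq[OF that] assms(17) norm by (simp add: one_type_stationary_prob_def)
  have "(0, 0) \<in> states 1" "(0, 1) \<in> states 1" "(1, 0) \<in> states 1" "(1, 1) \<in> states 1"
    by (simp_all add: states_def)
  note Pstar = this[THEN Pstar]
  have "P (x1, x2) = two_cell_weight \<alpha> a p \<beta> (x1, x2) / S.normaliser" if "x1 \<le> 2" "x2 \<le> 2" for x1 x2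
    using P[of "(x1, x2)"] that by (simp add: states_def)
  \<comment> \<open>With equal normalisers only weights are compared. For \<open>(k, 0)\<close> the
    ratio of \<open>a k / p k\<close> to \<open>1 / pstar\<close> is
    \<open>a k * pstar / p k\<close>; in the other patterns the ratio is the product of the
    \<open>a\<close> values of the particles present.\<close>
  thus ?thesis
    unfolding Pstar using pstar(1) by (simp add: two_cell_weight_def power2_eq_square)
qed

end
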